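(* For every randomized synchronous mutual search protocol for two agents on $n\ge 2$ sites that uses a bounded number of coin flips, the worst-case expected cost is at least $\frac{n-1}{8}$.
   Context: Sites are $V=\{0,\ldots,n-1\}$; two agents sit at two distinct sites and search for each other by queries "is there an agent at site $j$?". Time is discrete, with slots $t=1,2,\ldots$. A randomized synchronous mutual search protocol using a bounded number of coin flips is given by a number $b=b(n)$ and, for every site $i$ and every coin-flip string $\omega\in\{0,1\}^b$, a finite sequence $A(i,\omega)=(q_1,q_2,\ldots)$ with each $q_t\in\{\perp\}\cup(V\setminus\{i\})$, where $q_t=j$ means that an agent at $i$ with coin flips $\omega$ queries site $j$ in slot $t$, and $q_t=\perp$ means it makes no query in slot $t$ (before contact every answer is "no", so the schedule does not depend on answers). Both agents run this same protocol, each drawing its own string $\omega$ independently and uniformly at random. It is required that for all distinct sites $i,j$ and all $\omega,\omega'$, in each time slot at most one of $A(i,\omega)$, $A(j,\omega')$ has a non-$\perp$ entry, and that some slot contains a query of one of the two agents to the other's site. The cost of an execution with agents at $i,j$ using $\omega,\omega'$ is the number of non-$\perp$ queries of both agents in slots up to and including the first slot $t_0$ in which one agent queries the other's site. The worst-case expected cost of the protocol is the maximum over all placements $\{i,j\}$ of the expected cost over the random strings. *)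

theory Defs
  imports "HOL-Probability.Probability"
begin

text \<open>
  The sites are \<open>{..<n}\<close>. A schedule is a finite list whose entry at list index \<open>t - 1\<close> belongs to
  time slot \<open>t\<close>, for \<open>t = 1, 2, \<dots>\<close>; \<^term>\<open>None\<close> stands for ``no query''. An agent makes no query in
  slots after the end of its schedule.
\<close>

type_synonym schedule = "nat option list"

type_synonym protocol = "nat \<Rightarrow> bool list \<Rightarrow> schedule"

definition coin_strings :: "nat \<Rightarrow> bool list set" where
  "coin_strings b = {\<omega>. length \<omega> = b}"

definition query :: "schedule \<Rightarrow> nat \<Rightarrow> nat option" where
  "query q t = (if 1 \<le> t \<and> t \<le> length q then q ! (t - 1) else None)"

definition contact :: "protocol \<Rightarrow> nat \<Rightarrow> bool list \<Rightarrow> nat \<Rightarrow> bool list \<Rightarrow> nat \<Rightarrow> bool" where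
  "contact A i \<omega> j \<omega>' t \<longleftrightarrow> query (A i \<omega>) t = Some j \<or> query (A j \<omega>') t = Some i"

definition mutual_search_protocol :: "nat \<Rightarrow> nat \<Rightarrow> protocol \<Rightarrow> bool" where
  "mutual_search_protocol n b A \<longleftrightarrow>
     (\<forall>i<n. \<forall>\<omega>\<in>coin_strings b. set (A i \<omega>) \<subseteq> {None} \<union> Some ` ({..<n} - {i})) \<and>
     (\<forall>i<n. \<forall>j<n. i \<noteq> j \<longrightarrow> (\<forall>\<omega>\<in>coin_strings b. \<forall>\<omega>'\<in>coin_strings b.
        (\<forall>t. query (A i \<omega>) t = None \<or> query (A j \<omega>') t = None) \<and>
        (\<exists>t. contact A i \<omega> j \<omega>' t)))"

definition contact_slot :: "protocol \<Rightarrow> nat \<Rightarrow> bool list \<Rightarrow> nat \<Rightarrow> bool list \<Rightarrow> nat" where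
  "contact_slot A i \<omega> j \<omega>' = (LEAST t. contact A i \<omega> j \<omega>' t)"

definition num_queries :: "schedule \<Rightarrow> nat \<Rightarrow> nat" where
  "num_queries q T = card {t \<in> {1..T}. query q t \<noteq> None}"

definition cost :: "protocol \<Rightarrow> nat \<Rightarrow> bool list \<Rightarrow> nat \<Rightarrow> bool list \<Rightarrow> nat" where
  "cost A i \<omega> j \<omega>' =
     num_queries (A i \<omega>) (contact_slot A i \<omega> j \<omega>') +
     num_queries (A j \<omega>') (contact_slot A i \<omega> j \<omega>')"

definition expected_cost :: "nat \<Rightarrow> protocol \<Rightarrow> nat \<Rightarrow> nat \<Rightarrow> real" where
  "expected_cost b A i j =
     measure_pmf.expectation
       (pair_pmf (pmf_of_set (coin_strings b)) (pmf_of_set (coin_strings b)))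
       (\<lambda>(\<omega>, \<omega>'). real (cost A i \<omega> j \<omega>'))"

text \<open>
  A placement is represented by both of its orderings \<open>(i, j)\<close> and \<open>(j, i)\<close>; these have the same
  expected cost. The set of placements is nonempty exactly when \<open>n \<ge> 2\<close>.
\<close>

definition worst_case_expected_cost :: "nat \<Rightarrow> nat \<Rightarrow> protocol \<Rightarrow> real" where
  "worst_case_expected_cost n b A = Max {expected_cost b A i j | i j. i < n \<and> j < n \<and> i \<noteq> j}"

end

theory Submission
  imports Defs
begin

text \<open>
  If an execution costs at most \<open>K\<close>, then one of the two agents has the other's site among its first
  \<open>K\<close> queried sites. For each site and each coin-flip string these are at most \<open>K\<close> sites, so under a
  uniformly random placement this happens for a given agent with probability at most \<open>K / (n - 1)\<close>,
  and the cost exceeds \<open>K\<close> with probability at least \<open>1 - 2 * K / (n - 1)\<close>. Summing these tail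
  probabilities over \<open>K < m\<close> bounds the average expected cost from below by
  \<open>m * (n - m) / (n - 1)\<close>, which for \<open>m = n div 2\<close> is at least \<open>(n + 1) / 4\<close>.
\<close>

lemma sum_prob_eq_expectation_card:
  assumes "finite J"
  shows "(\<Sum>j\<in>J. measure_pmf.prob p {x. P j x})
    = measure_pmf.expectation p (\<lambda>x. real (card {j \<in> J. P j x}))"
proof -
  have "(\<Sum>j\<in>J. measure_pmf.prob p {x. P j x})
      = measure_pmf.expectation p (\<lambda>x. \<Sum>j\<in>J. indicator {x. P j x} x)"
    by (subst Bochner_Integration.integral_sum) (simp_all flip: less_top)
  then show ?thesis
    using assms by (simp add: indicator_def Int_def)
qed

lemma sum_prob_greater_le_expectation:
  fixes X :: "'a \<Rightarrow> nat"
  assumes "integrable (measure_pmf p) (\<lambda>x. real (X x))"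
  shows "(\<Sum>K<m. measure_pmf.prob p {x. K < X x}) \<le> measure_pmf.expectation p (\<lambda>x. real (X x))"
proof -
  have "card {K \<in> {..<m}. K < X x} \<le> X x" for x
    using card_mono[of "{..<X x}" "{K \<in> {..<m}. K < X x}"] by auto
  then show ?thesis
    using assms by (simp add: sum_prob_eq_expectation_card integral_mono')
qed

lemma sum_prob_mem_le:
  assumes "finite J" and "\<And>x. x \<in> set_pmf p \<Longrightarrow> card (J \<inter> S x) \<le> k"
  shows "(\<Sum>j\<in>J. measure_pmf.prob p {x. j \<in> S x}) \<le> real k"
proof -
  have "measure_pmf.expectation p (\<lambda>x. real (card {j \<in> J. j \<in> S x}))
      \<le> measure_pmf.expectation p (\<lambda>x. real k)"
    using assms(2) by (intro integral_mono_AE') (simp_all add: AE_measure_pmf_iff Int_def)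
  then show ?thesis
    using assms(1) by (simp add: sum_prob_eq_expectation_card)
qed

definition queried_sites :: "schedule \<Rightarrow> nat list" where
  "queried_sites q = List.map_filter id q"

lemma queried_sites_append: "queried_sites (q @ r) = queried_sites q @ queried_sites r"
  by (simp add: queried_sites_def List.map_filter_def)

lemma num_queries_eq_length_queried_sites: "num_queries q t = length (queried_sites (take t q))"
proof -
  have "{s \<in> {1..t}. query q s \<noteq> None} = Suc ` {i. i < length (take t q) \<and> take t q ! i \<noteq> None}"
  proof (rule set_eqI)
    fix s show "s \<in> {s \<in> {1..t}. query q s \<noteq> None} \<longleftrightarrow>
        s \<in> Suc ` {i. i < length (take t q) \<and> take t q ! i \<noteq> None}"
      by (cases s) (auto simp: query_def)
  qed
  then show ?thesis
    by (simp add: num_queries_def queried_sites_def List.map_filter_def length_filter_conv_card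
        card_image del: length_take)
qed

lemma take_num_queries_queried_sites:
  "take (num_queries q t) (queried_sites q) = queried_sites (take t q)"
  using queried_sites_append[of "take t q" "drop t q"]
  by (simp add: num_queries_eq_length_queried_sites)

definition early_sites :: "nat \<Rightarrow> schedule \<Rightarrow> nat set" where
  "early_sites K q = set (take K (queried_sites q))"

lemma finite_early_sites: "finite (early_sites K q)"
  by (simp add: early_sites_def)

lemma card_early_sites_le: "card (early_sites K q) \<le> K"
  using card_length[of "take K (queried_sites q)"] by (simp add: early_sites_def)

lemma query_mem_early_sites:
  assumes "query q t = Some j" and "num_queries q t \<le> K"
  shows "j \<in> early_sites K q"
proof -
  have "1 \<le> t" "t \<le> length q" "q ! (t - 1) = Some j"
    using assms(1) by (auto simp: query_def split: if_splits)
  then have "Some j \<in> set (take t q)"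
    using nth_mem[of "t - 1" "take t q"] by simp
  then have "j \<in> set (queried_sites (take t q))"
    unfolding queried_sites_def List.map_filter_def by force
  also have "\<dots> = early_sites (num_queries q t) q"
    by (simp add: early_sites_def take_num_queries_queried_sites)
  also have "\<dots> \<subseteq> early_sites K q"
    unfolding early_sites_def using assms(2) by (rule set_take_subset_set_take)
  finally show ?thesis .
qed

lemma cost_le_imp_mem_early_sites:
  assumes "\<exists>t. contact A i \<omega> j \<omega>' t" and "cost A i \<omega> j \<omega>' \<le> K"
  shows "j \<in> early_sites K (A i \<omega>) \<or> i \<in> early_sites K (A j \<omega>')"
proof -
  define t where "t = contact_slot A i \<omega> j \<omega>'"
  have "num_queries (A i \<omega>) t \<le> K" "num_queries (A j \<omega>') t \<le> K"
    using assms(2) by (simp_all add: cost_def t_def)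
  moreover have "contact A i \<omega> j \<omega>' t"
    unfolding t_def contact_slot_def using assms(1) by (rule LeastI_ex)
  ultimately show ?thesis
    unfolding contact_def using query_mem_early_sites by blast
qed

lemma finite_coin_strings: "finite (coin_strings b)"
  using finite_lists_length_eq[of "UNIV :: bool set" b] by (simp add: coin_strings_def)

lemma coin_strings_nonempty: "coin_strings b \<noteq> {}"
  unfolding coin_strings_def by (auto intro: Ex_list_of_length)

definition early_query_prob :: "nat \<Rightarrow> protocol \<Rightarrow> nat \<Rightarrow> nat \<Rightarrow> nat \<Rightarrow> real" where
  "early_query_prob b A K i j =
     measure_pmf.prob (pmf_of_set (coin_strings b)) {\<omega>. j \<in> early_sites K (A i \<omega>)}"

lemma sum_early_query_prob_le:
  assumes "finite J"
  shows "(\<Sum>j\<in>J. early_query_prob b A K i j) \<le> real K"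
  unfolding early_query_prob_def
proof (rule sum_prob_mem_le[OF assms])
  fix \<omega>
  have "card (J \<inter> early_sites K (A i \<omega>)) \<le> card (early_sites K (A i \<omega>))"
    by (intro card_mono finite_early_sites) simp
  also have "\<dots> \<le> K"
    by (rule card_early_sites_le)
  finally show "card (J \<inter> early_sites K (A i \<omega>)) \<le> K" .
qed

lemma prob_cost_greater_ge:
  assumes "mutual_search_protocol n b A" "i < n" "j < n" "i \<noteq> j"
  shows "1 - early_query_prob b A K i j - early_query_prob b A K j i \<le>
    measure_pmf.prob (pair_pmf (pmf_of_set (coin_strings b)) (pmf_of_set (coin_strings b)))
      {(\<omega>, \<omega>'). K < cost A i \<omega> j \<omega>'}" (is "_ \<le> measure_pmf.prob ?pp ?late")
proof -
  let ?early_i = "fst -` {\<omega>. j \<in> early_sites K (A i \<omega>)} :: (bool list \<times> bool list) set"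
  let ?early_j = "snd -` {\<omega>. i \<in> early_sites K (A j \<omega>)} :: (bool list \<times> bool list) set"
  have prob_early_i: "measure_pmf.prob ?pp ?early_i = early_query_prob b A K i j"
    by (simp only: early_query_prob_def map_fst_pair_pmf flip: measure_map_pmf)
  have prob_early_j: "measure_pmf.prob ?pp ?early_j = early_query_prob b A K j i"
    by (simp only: early_query_prob_def map_snd_pair_pmf flip: measure_map_pmf)
  have "(\<omega>, \<omega>') \<in> ?early_i \<union> ?early_j \<union> ?late"
    if "\<omega> \<in> coin_strings b" "\<omega>' \<in> coin_strings b" for \<omega> \<omega>'
  proof -
    have "\<exists>t. contact A i \<omega> j \<omega>' t"
      using assms that unfolding mutual_search_protocol_def by blast
    then show ?thesis
      using cost_le_imp_mem_early_sites[of A i \<omega> j \<omega>' K] by auto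
  qed
  then have "1 = measure_pmf.prob ?pp (?early_i \<union> ?early_j \<union> ?late)"
    by (intro measure_pmf.prob_eq_1[THEN iffD2, symmetric])
      (auto simp: AE_measure_pmf_iff finite_coin_strings coin_strings_nonempty)
  also have "\<dots> \<le> measure_pmf.prob ?pp ?early_i + measure_pmf.prob ?pp ?early_j
      + measure_pmf.prob ?pp ?late"
    by (intro order_trans[OF measure_Un_le] add_right_mono measure_Un_le) simp_all
  finally show ?thesis
    unfolding prob_early_i prob_early_j by linarith
qed

lemma expected_cost_ge:
  assumes "mutual_search_protocol n b A" "i < n" "j < n" "i \<noteq> j"
  shows "(\<Sum>K<m. 1 - early_query_prob b A K i j - early_query_prob b A K j i)
    \<le> expected_cost b A i j"
proof -
  let ?p = "pmf_of_set (coin_strings b)"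
  let ?cost = "\<lambda>x. cost A i (fst x) j (snd x)"
  have integrable_cost: "integrable (measure_pmf (pair_pmf ?p ?p)) (\<lambda>x. real (?cost x))"
    by (intro integrable_measure_pmf_finite) (simp add: finite_coin_strings coin_strings_nonempty)
  have "(\<Sum>K<m. 1 - early_query_prob b A K i j - early_query_prob b A K j i)
      \<le> (\<Sum>K<m. measure_pmf.prob (pair_pmf ?p ?p) {x. K < ?cost x})"
    using assms by (intro sum_mono prob_cost_greater_ge[unfolded case_prod_unfold])
  also have "\<dots> \<le> measure_pmf.expectation (pair_pmf ?p ?p) (\<lambda>x. real (?cost x))"
    by (rule sum_prob_greater_le_expectation[OF integrable_cost])
  finally show ?thesis
    by (simp add: expected_cost_def case_prod_unfold)
qed

definition placements :: "nat \<Rightarrow> (nat \<times> nat) set" where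
  "placements n = (SIGMA i:{..<n}. {..<n} - {i})"

lemma card_placements: "card (placements n) = n * (n - 1)"
  by (simp add: placements_def)

lemma sum_placements_swap: "(\<Sum>(i, j)\<in>placements n. f j i) = (\<Sum>(i, j)\<in>placements n. f i j)"
  by (rule sum.reindex_bij_witness[of _ prod.swap prod.swap]) (auto simp: placements_def)

lemma sum_placements_early_query_prob_le:
  "(\<Sum>(i, j)\<in>placements n. early_query_prob b A K i j) \<le> real n * real K"
proof -
  have "(\<Sum>(i, j)\<in>placements n. early_query_prob b A K i j)
      = (\<Sum>i<n. \<Sum>j\<in>{..<n} - {i}. early_query_prob b A K i j)"
    unfolding placements_def by (subst sum.Sigma) auto
  also have "\<dots> \<le> (\<Sum>i<n. real K)"
    by (intro sum_mono sum_early_query_prob_le) simp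
  finally show ?thesis
    by simp
qed

lemma sum_placements_expected_cost_ge:
  assumes "mutual_search_protocol n b A"
  shows "real n * (real m * (real n - real m)) \<le> (\<Sum>(i, j)\<in>placements n. expected_cost b A i j)"
proof -
  let ?p = "early_query_prob b A"
  have "real n * (real m * (real n - real m)) = (\<Sum>K<m. real n * (real n - 1 - 2 * real K))"
    by (induction m) (simp_all add: algebra_simps)
  also have "\<dots> \<le> (\<Sum>K<m. \<Sum>(i, j)\<in>placements n. 1 - ?p K i j - ?p K j i)"
  proof (rule sum_mono)
    fix K
    have "(\<Sum>(i, j)\<in>placements n. 1 - ?p K i j - ?p K j i)
        = real (n * (n - 1)) - 2 * (\<Sum>(i, j)\<in>placements n. ?p K i j)"
      using sum_placements_swap[of "?p K" n]
      by (simp add: case_prod_unfold sum_subtractf card_placements)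
    moreover have "real (n * (n - 1)) = real n * (real n - 1)"
      by (cases n) (simp_all add: algebra_simps)
    ultimately show "real n * (real n - 1 - 2 * real K)
        \<le> (\<Sum>(i, j)\<in>placements n. 1 - ?p K i j - ?p K j i)"
      using sum_placements_early_query_prob_le[of b A K n] by (simp add: algebra_simps)
  qed
  also have "\<dots> = (\<Sum>(i, j)\<in>placements n. \<Sum>K<m. 1 - ?p K i j - ?p K j i)"
    by (subst sum.swap) (simp add: case_prod_unfold)
  also have "\<dots> \<le> (\<Sum>(i, j)\<in>placements n. expected_cost b A i j)"
    using assms by (intro sum_mono) (auto simp: placements_def intro!: expected_cost_ge)
  finally show ?thesis .
qed

lemma sum_placements_expected_cost_le:
  "(\<Sum>(i, j)\<in>placements n. expected_cost b A i j)
    \<le> real (n * (n - 1)) * worst_case_expected_cost n b A"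
proof -
  let ?costs = "(\<lambda>(i, j). expected_cost b A i j) ` placements n"
  have "worst_case_expected_cost n b A = Max ?costs"
    unfolding worst_case_expected_cost_def placements_def by (rule arg_cong[of _ _ Max]) auto
  moreover have "finite ?costs"
    by (simp add: placements_def)
  ultimately show ?thesis
    unfolding card_placements[symmetric] by (intro sum_bounded_above) simp
qed

lemma worst_case_expected_cost_ge:
  assumes "n \<ge> 2" and "mutual_search_protocol n b A"
  shows "real m * (real n - real m) / (real n - 1) \<le> worst_case_expected_cost n b A"
proof -
  have "real n * (real m * (real n - real m)) \<le> real (n * (n - 1)) * worst_case_expected_cost n b A"
    using sum_placements_expected_cost_ge[OF assms(2)] sum_placements_expected_cost_le
    by (rule order_trans)
  also have "\<dots> = real n * ((real n - 1) * worst_case_expected_cost n b A)"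
    using assms(1) by simp
  finally have "real m * (real n - real m) \<le> (real n - 1) * worst_case_expected_cost n b A"
    by (rule mult_left_le_imp_le) (use assms(1) in simp)
  then show ?thesis
    using assms(1) by (simp add: divide_simps mult.commute)
qed

theorem theorem5:
  fixes n b :: nat and A :: protocol
  assumes "n \<ge> 2"
    and "mutual_search_protocol n b A"
  shows "worst_case_expected_cost n b A \<ge> (real n - 1) / 8"
proof -
  define m where "m = n div 2"
  have "(real n - 1) / 8 \<le> (real n + 1) / 4"
    by simp
  also have "\<dots> = ((real n)\<^sup>2 - 1) / 4 / (real n - 1)"
    using assms(1) by (simp add: field_simps power2_eq_square)
  also have "\<dots> \<le> real m * (real n - real m) / (real n - 1)"
  proof (rule divide_right_mono)
    have "n = 2 * m \<or> n = 2 * m + 1"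
      by (auto simp: m_def)
    then show "((real n)\<^sup>2 - 1) / 4 \<le> real m * (real n - real m)"
      by (auto simp: field_simps power2_eq_square)
  qed (use assms(1) in simp)
  also have "\<dots> \<le> worst_case_expected_cost n b A"
    using assms by (rule worst_case_expected_cost_ge)
  finally show ?thesis .
qed

end
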